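(* Let $\beta=(\beta_x,\beta_y)\in(0,+\infty)^2$, $\beta_{\min}=\min(\beta_x,\beta_y)$, $z=(x,y)\in\mathcal Z$, and let $f\in\Gamma_0(\mathcal X)$. Then $$\mathcal G_\beta(z)\ \le\ (1+\|x\|+\|y\|)\sqrt{\mathcal D(z)}+\frac1{2\beta_{\min}}\mathcal D(z).$$
   Context: $\mathcal X,\mathcal Y$ are Euclidean spaces, $\mathcal Z=\mathcal X\times\mathcal Y$. $\Gamma_0(\mathcal X)$ is the set of proper, lower semicontinuous, convex functions $\mathcal X\to\mathbb R\cup\{+\infty\}$. $A:\mathcal X\to\mathcal Y$ is linear with adjoint $A^T$, and $b\in\mathcal Y$. $f^*(\mu)=\sup_x\langle\mu,x\rangle-f(x)$ is the Fenchel conjugate. The self-centered smoothed duality gap is $$\mathcal G_\beta(z)=f(x)-f(p)+\langle A(x-p),y\rangle-\tfrac{\beta_x}{2}\|p-x\|^2+\tfrac1{2\beta_y}\|Ax-b\|^2,\qquad p=\mathrm{Prox}_{\beta_x^{-1}f}\big(x-\tfrac1{\beta_x}A^Ty\big),$$ where $\mathrm{Prox}_{sf}(x)=\arg\min_{x'}f(x')+\frac1{2s}\|x'-x\|^2$. The projected duality gap is $$\mathcal D(z)=|f(x)+f^*(a)+\langle b,y\rangle|^2+\|a+A^Ty\|^2+\|Ax-b\|^2,\qquad a=\mathrm{Proj}_{\mathrm{dom} f^*}(-A^Ty),$$ where $\mathrm{Proj}_S$ is the Euclidean projection onto $S$. The saddle point problem $\min_x\max_y f(x)+\langle Ax-b,y\rangle$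 is assumed throughout to have a solution. *)

theory Defs
  imports "HOL-Analysis.Analysis"
begin

definition proper_fun :: "('a \<Rightarrow> ereal) \<Rightarrow> bool" where
  "proper_fun f \<longleftrightarrow> (\<forall>x. f x \<noteq> -\<infinity>) \<and> (\<exists>x. f x \<noteq> \<infinity>)"

definition lsc_fun :: "('a::topological_space \<Rightarrow> ereal) \<Rightarrow> bool" where
  "lsc_fun f \<longleftrightarrow> (\<forall>x. f x \<le> Liminf (at x) f)"

(* Only used for functions that avoid -\<infinity>, so the sum on the right is never
   \<infinity> + (-\<infinity>). *)
definition convex_fun :: "('a::real_vector \<Rightarrow> ereal) \<Rightarrow> bool" where
  "convex_fun f \<longleftrightarrow>
    (\<forall>x y. \<forall>u\<ge>0. \<forall>v\<ge>0. u + v = 1 \<longrightarrow>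
       f (u *\<^sub>R x + v *\<^sub>R y) \<le> ereal u * f x + ereal v * f y)"

definition Gamma0 :: "('a::euclidean_space \<Rightarrow> ereal) set" where
  "Gamma0 = {f. proper_fun f \<and> lsc_fun f \<and> convex_fun f}"

definition fenchel_conj :: "('a::real_inner \<Rightarrow> ereal) \<Rightarrow> 'a \<Rightarrow> ereal" where
  "fenchel_conj f \<mu> = (SUP x. ereal (\<mu> \<bullet> x) - f x)"

definition eff_dom :: "('a \<Rightarrow> ereal) \<Rightarrow> 'a set" where
  "eff_dom f = {x. f x < \<infinity>}"

definition prox :: "real \<Rightarrow> ('a::euclidean_space \<Rightarrow> ereal) \<Rightarrow> 'a \<Rightarrow> 'a" where
  "prox s f x = arg_min (\<lambda>u. f u + ereal (1 / (2 * s) * (norm (u - x))\<^sup>2)) (\<lambda>u. True)"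

definition Lagrangian ::
  "('a::euclidean_space \<Rightarrow> ereal) \<Rightarrow> ('a \<Rightarrow> 'b::euclidean_space) \<Rightarrow> 'b \<Rightarrow> 'a \<Rightarrow> 'b \<Rightarrow> ereal" where
  "Lagrangian f A b x y = f x + ereal ((A x - b) \<bullet> y)"

definition saddle_point ::
  "('a::euclidean_space \<Rightarrow> ereal) \<Rightarrow> ('a \<Rightarrow> 'b::euclidean_space) \<Rightarrow> 'b \<Rightarrow> 'a \<times> 'b \<Rightarrow> bool" where
  "saddle_point f A b = (\<lambda>(xs, ys).
     (\<forall>y. Lagrangian f A b xs y \<le> Lagrangian f A b xs ys) \<and>
     (\<forall>x. Lagrangian f A b xs ys \<le> Lagrangian f A b x ys))"

definition smoothed_gap ::
  "('a::euclidean_space \<Rightarrow> ereal) \<Rightarrow> ('a \<Rightarrow> 'b::euclidean_space) \<Rightarrow> 'b \<Rightarrow>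
   real \<times> real \<Rightarrow> 'a \<times> 'b \<Rightarrow> ereal" where
  "smoothed_gap f A b = (\<lambda>(\<beta>x, \<beta>y) (x, y).
     let p = prox (1 / \<beta>x) f (x - (1 / \<beta>x) *\<^sub>R adjoint A y)
     in f x - f p + ereal (A (x - p) \<bullet> y - \<beta>x / 2 * (norm (p - x))\<^sup>2
                           + 1 / (2 * \<beta>y) * (norm (A x - b))\<^sup>2))"

(* The effective domain of the conjugate need not be closed. Where the point to be
   projected has no nearest point in it, closest_point returns an unspecified vector.
   The value \<infinity> is taken when x is outside the effective domain of f. *)
definition projected_gap ::
  "('a::euclidean_space \<Rightarrow> ereal) \<Rightarrow> ('a \<Rightarrow> 'b::euclidean_space) \<Rightarrow> 'b \<Rightarrow>
   'a \<times> 'b \<Rightarrow> ereal" where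
  "projected_gap f A b = (\<lambda>(x, y).
     let a = closest_point (eff_dom (fenchel_conj f)) (- adjoint A y)
     in \<bar>f x + fenchel_conj f a + ereal (b \<bullet> y)\<bar>\<^sup>2
        + ereal ((norm (a + adjoint A y))\<^sup>2) + ereal ((norm (A x - b))\<^sup>2))"

(* Applied to values in [0, \<infinity>] only. *)
definition ereal_sqrt :: "ereal \<Rightarrow> ereal" where
  "ereal_sqrt r = (if r = \<infinity> then \<infinity> else ereal (sqrt (real_of_ereal r)))"

end

(* The prox point p enters only through the Fenchel-Young inequality f p + f* a >= <a, p>.
   With w = a + A^T y and r = A x - b it gives
     f x - f p + <A (x - p), y> <= (f x + f* a + <b, y>) + <r, y> - <w, x> + <w, x - p>.
   Young's inequality absorbs <w, x - p> into the quadratic term, leaving |w|^2 / (2 \<beta>x), and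
   Cauchy-Schwarz bounds the rest, each of the three residuals being at most sqrt D. *)
theory Submission
  imports Defs
begin

lemma fenchel_young: "ereal (\<mu> \<bullet> x) - f x \<le> fenchel_conj f \<mu>"
  unfolding fenchel_conj_def by (rule SUP_upper) simp

text \<open>A point where \<open>f\<close> is finite gives a finite lower bound. Hence
  \<open>f x + fenchel_conj f a\<close> is never a sum of opposite infinities.\<close>

lemma fenchel_conj_not_MInfty:
  assumes "proper_fun f"
  shows "fenchel_conj f \<mu> \<noteq> -\<infinity>"
proof -
  obtain u where u: "f u \<noteq> \<infinity>" "f u \<noteq> -\<infinity>"
    using assms unfolding proper_fun_def by blast
  show ?thesis
    using fenchel_young[of \<mu> u f] u by (cases "f u") auto
qed

text \<open>Complete the square in \<open>d\<close>; equality holds at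
  \<open>d = w /\<^sub>R c\<close>.\<close>

lemma inner_minus_quadratic_le:
  fixes w d :: "'a::real_inner"
  assumes "c > 0"
  shows "w \<bullet> d - c / 2 * (norm d)\<^sup>2 \<le> (norm w)\<^sup>2 / (2 * c)"
proof -
  have "0 \<le> (norm (w - c *\<^sub>R d))\<^sup>2 / (2 * c)"
    using assms by simp
  also have "(norm (w - c *\<^sub>R d))\<^sup>2 = (norm w)\<^sup>2 - 2 * c * (w \<bullet> d) + c\<^sup>2 * (norm d)\<^sup>2"
    unfolding power2_norm_eq_inner
    by (simp add: inner_diff_left inner_diff_right inner_commute power2_eq_square)
  finally show ?thesis
    using assms by (simp add: field_simps power2_eq_square)
qed

text \<open>The estimate for finite values, in real arithmetic: \<open>fx\<close>,
  \<open>fp\<close>, \<open>fa\<close> stand for \<open>f x\<close>, \<open>f p\<close>,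
  \<open>fenchel_conj f a\<close>, and \<open>FY\<close> is Fenchel-Young at \<open>p\<close> and
  \<open>a\<close>.\<close>

lemma smoothed_gap_real_bound:
  fixes A :: "'a::euclidean_space \<Rightarrow> 'b::euclidean_space"
  assumes "linear A" "\<beta>x > 0" "\<beta>y > 0"
    and FY: "a \<bullet> p - fp \<le> fa"
    and D: "D = (fx + fa + b \<bullet> y)\<^sup>2 + (norm (a + adjoint A y))\<^sup>2 + (norm (A x - b))\<^sup>2"
  shows "fx - fp + (A (x - p) \<bullet> y - \<beta>x / 2 * (norm (p - x))\<^sup>2
           + 1 / (2 * \<beta>y) * (norm (A x - b))\<^sup>2)
         \<le> (1 + norm x + norm y) * sqrt D + 1 / (2 * min \<beta>x \<beta>y) * D"
proof -
  define w where "w = a + adjoint A y"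
  define r where "r = A x - b"
  define t where "t = fx + fa + b \<bullet> y"
  have D': "D = t\<^sup>2 + (norm w)\<^sup>2 + (norm r)\<^sup>2"
    unfolding D w_def r_def t_def ..
  have t: "\<bar>t\<bar> \<le> sqrt D" and w: "norm w \<le> sqrt D" and r: "norm r \<le> sqrt D"
    unfolding D' by (auto intro!: real_le_rsqrt)
  have adj: "A u \<bullet> y = u \<bullet> adjoint A y" for u
    by (simp add: adjoint_works[OF assms(1)])
  have "fx - fp + A (x - p) \<bullet> y \<le> fx + fa - a \<bullet> p + A (x - p) \<bullet> y"
    using FY by simp
  \<comment> \<open>Moving \<open>A\<close> to the other side and writing A^T y = w - a turns the
    \<open>p\<close>-terms into \<open>w \<bullet> (x - p)\<close> and leaves
    \<open>- (a \<bullet> x)\<close>, which equals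
    \<open>r \<bullet> y + b \<bullet> y - w \<bullet> x\<close>.\<close>
  also have "\<dots> = t + r \<bullet> y - w \<bullet> x + w \<bullet> (x - p)"
    unfolding t_def r_def w_def
    by (simp add: adj inner_diff_left inner_diff_right inner_add_left inner_commute[of "adjoint A y"])
  finally have 1: "fx - fp + A (x - p) \<bullet> y \<le> t + r \<bullet> y - w \<bullet> x + w \<bullet> (x - p)" .
  have 2: "w \<bullet> (x - p) - \<beta>x / 2 * (norm (p - x))\<^sup>2 \<le> (norm w)\<^sup>2 / (2 * \<beta>x)"
    using inner_minus_quadratic_le[OF assms(2), of w "x - p"] by (simp add: norm_minus_commute)
  have "r \<bullet> y \<le> norm r * norm y" "- (w \<bullet> x) \<le> norm w * norm x"
    using norm_cauchy_schwarz[of r y] norm_cauchy_schwarz[of "- w" x] by simp_all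
  moreover have "norm r * norm y \<le> norm y * sqrt D" "norm w * norm x \<le> norm x * sqrt D"
    using r w by (simp_all add: mult_right_mono mult.commute[of _ "sqrt D"])
  \<comment> \<open>The summands 1, \<open>norm x\<close>, \<open>norm y\<close> of the factor come
    from \<open>t\<close>, \<open>w \<bullet> x\<close>, \<open>r \<bullet> y\<close> in this
    order.\<close>
  ultimately have 3: "t + r \<bullet> y - w \<bullet> x \<le> (1 + norm x + norm y) * sqrt D"
    using t by (simp add: algebra_simps)
  have "(norm w)\<^sup>2 / (2 * \<beta>x) \<le> (norm w)\<^sup>2 / (2 * min \<beta>x \<beta>y)"
       "(norm r)\<^sup>2 / (2 * \<beta>y) \<le> (norm r)\<^sup>2 / (2 * min \<beta>x \<beta>y)"
    using assms by (auto intro!: divide_left_mono mult_pos_pos)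
  \<comment> \<open>The difference of the numerators is \<open>t\<^sup>2\<close>, which is
    nonnegative.\<close>
  moreover have "((norm w)\<^sup>2 + (norm r)\<^sup>2) / (2 * min \<beta>x \<beta>y) \<le> D / (2 * min \<beta>x \<beta>y)"
    unfolding D' using assms by (intro divide_right_mono) auto
  ultimately have 4: "(norm w)\<^sup>2 / (2 * \<beta>x) + (norm r)\<^sup>2 / (2 * \<beta>y) \<le> 1 / (2 * min \<beta>x \<beta>y) * D"
    by (simp add: add_divide_distrib)
  show ?thesis
    unfolding r_def[symmetric] using 1 2 3 4 by simp
qed

theorem theorem7:
  fixes f :: "'a::euclidean_space \<Rightarrow> ereal"
    and A :: "'a \<Rightarrow> 'b::euclidean_space"
    and b :: 'b and x :: 'a and y :: 'b
    and \<beta>x \<beta>y :: real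
  assumes "f \<in> Gamma0"
    and "linear A"
    and "\<exists>zs. saddle_point f A b zs"
    and "\<beta>x > 0" and "\<beta>y > 0"
  shows "smoothed_gap f A b (\<beta>x, \<beta>y) (x, y)
    \<le> ereal (1 + norm x + norm y) * ereal_sqrt (projected_gap f A b (x, y))
      + ereal (1 / (2 * min \<beta>x \<beta>y)) * projected_gap f A b (x, y)"
proof -
  have proper: "proper_fun f"
    using assms(1) by (simp add: Gamma0_def)
  then have f_MInf: "f u \<noteq> -\<infinity>" for u
    by (simp add: proper_fun_def)
  define a where "a = closest_point (eff_dom (fenchel_conj f)) (- adjoint A y)"
  define p where "p = prox (1 / \<beta>x) f (x - (1 / \<beta>x) *\<^sub>R adjoint A y)"
  have fa_MInf: "fenchel_conj f a \<noteq> -\<infinity>"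
    using proper by (rule fenchel_conj_not_MInfty)
  have gap: "smoothed_gap f A b (\<beta>x, \<beta>y) (x, y) = f x - f p
      + ereal (A (x - p) \<bullet> y - \<beta>x / 2 * (norm (p - x))\<^sup>2 + 1 / (2 * \<beta>y) * (norm (A x - b))\<^sup>2)"
    by (simp add: smoothed_gap_def p_def Let_def)
  have pgap: "projected_gap f A b (x, y) = \<bar>f x + fenchel_conj f a + ereal (b \<bullet> y)\<bar>\<^sup>2
      + ereal ((norm (a + adjoint A y))\<^sup>2) + ereal ((norm (A x - b))\<^sup>2)"
    by (simp add: projected_gap_def a_def Let_def)
  \<comment> \<open>Strict positivity matters because 0 times \<infinity> is 0 in
    \<open>ereal\<close>.\<close>
  have pos: "1 + norm x + norm y > 0" "1 / (2 * min \<beta>x \<beta>y) > 0"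
    using assms(4,5) by (auto simp: add_pos_nonneg)
  show ?thesis
  proof (cases "f x = \<infinity> \<or> fenchel_conj f a = \<infinity>")
    \<comment> \<open>The right-hand side is \<infinity>. This also covers a missing nearest point
      whose unspecified substitute \<open>a\<close> lies outside the domain of the
      conjugate.\<close>
    case True
    then have "projected_gap f A b (x, y) = \<infinity>"
      using fa_MInf f_MInf[of x] unfolding pgap by (auto simp: power2_eq_square)
    then show ?thesis
      using pos by (simp add: ereal_sqrt_def)
  next
    case False
    then obtain fx fa where fx: "f x = ereal fx" and fa: "fenchel_conj f a = ereal fa"
      using fa_MInf f_MInf[of x] by (metis ereal_cases)
    show ?thesis
    proof (cases "f p")
      case (real fp)
      define D where "D = (fx + fa + b \<bullet> y)\<^sup>2 + (norm (a + adjoint A y))\<^sup>2 + (norm (A x - b))\<^sup>2"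
      have "a \<bullet> p - fp \<le> fa"
        using fenchel_young[of a p f] by (simp add: real fa)
      note bound = smoothed_gap_real_bound[OF assms(2,4,5) this D_def]
      have D: "projected_gap f A b (x, y) = ereal D"
        unfolding pgap D_def fx fa by simp
      show ?thesis
        using bound unfolding gap D fx real ereal_sqrt_def by simp
    next
      \<comment> \<open>Since \<open>f x\<close> is finite, the smoothed gap is -\<infinity>
        here.\<close>
      case PInf
      then show ?thesis
        by (simp add: gap fx)
    next
      case MInf
      then show ?thesis
        using f_MInf by blast
    qed
  qed
qed

end
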